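(* Consider the Gaussian sequence model with parameter space $\Theta(k_n,\tau_n)$, and let $\epsilon_n=k_n/n$, $\mu_n=\tau_n/\sigma_n$, $\nu_n=\sqrt{2\log\epsilon_n^{-1}}$. Suppose $\epsilon_n\to0$ and $\mu_n=\omega(\sqrt{\log\epsilon_n^{-1}})$ as $n\to\infty$. Then the optimally tuned soft thresholding estimator has supremum risk $$\inf_{\lambda}\sup_{\theta\in\Theta(k_n,\tau_n)}\mathbb E_\theta\|\hat\eta_S(y,\lambda)-\theta\|_2^2=n\sigma_n^2\left(2\epsilon_n\log\epsilon_n^{-1}-6\epsilon_n\log\nu_n\,(1+o(1))\right).$$
   Context: Model: for each $n$, one observes $y=(y_1,\dots,y_n)$ with $y_i=\theta_i+\sigma_n z_i$, where $z_i$ are i.i.d. $\mathcal N(0,1)$, $\sigma_n>0$ and $\theta\in\mathbb R^n$. For integers $1\le k_n\le n$ and $\tau_n>0$, $$\Theta(k_n,\tau_n)=\{\theta\in\mathbb R^n:\ \|\theta\|_0\le k_n,\ \|\theta\|_2^2\le k_n\tau_n^2\},$$ where $\|\theta\|_0$ is the number of nonzero coordinates. The soft thresholding estimator has coordinates $[\hat\eta_S(y,\lambda)]_i=\mathrm{sign}(y_i)(|y_i|-\lambda)_+$ with tuning parameter $\lambda\ge0$ (deterministic, possibly depending on $n,k_n,\tau_n,\sigma_n$; the infimum is over $\lambda\geq 0$). Here $o(1)$ denotes a sequence tending to $0$ as $n\to\infty$, and $a_n=\omega(b_n)$ means $b_n/a_n\to 0$. *)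

theory Defs
  imports "HOL-Probability.Probability"
begin

text \<open>Vectors of length n are functions on the index set {1..n}, extended by \<open>undefined\<close>.\<close>

definition l0_norm :: "nat \<Rightarrow> (nat \<Rightarrow> real) \<Rightarrow> nat" where
  "l0_norm n \<theta> = card {i \<in> {1..n}. \<theta> i \<noteq> 0}"

definition l2_norm_sq :: "nat \<Rightarrow> (nat \<Rightarrow> real) \<Rightarrow> real" where
  "l2_norm_sq n \<theta> = (\<Sum>i\<in>{1..n}. (\<theta> i)\<^sup>2)"

definition sparse_space :: "nat \<Rightarrow> nat \<Rightarrow> real \<Rightarrow> (nat \<Rightarrow> real) set" where
  "sparse_space n k \<tau> =
     {\<theta> \<in> {1..n} \<rightarrow>\<^sub>E UNIV. l0_norm n \<theta> \<le> k \<and> l2_norm_sq n \<theta> \<le> real k * \<tau>\<^sup>2}"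

definition gauss_noise :: "nat \<Rightarrow> (nat \<Rightarrow> real) measure" where
  "gauss_noise n = Pi\<^sub>M {1..n} (\<lambda>_. density lborel std_normal_density)"

definition observation :: "nat \<Rightarrow> real \<Rightarrow> (nat \<Rightarrow> real) \<Rightarrow> (nat \<Rightarrow> real) \<Rightarrow> (nat \<Rightarrow> real)" where
  "observation n \<sigma> \<theta> z = (\<lambda>i\<in>{1..n}. \<theta> i + \<sigma> * z i)"

definition soft_threshold :: "nat \<Rightarrow> real \<Rightarrow> (nat \<Rightarrow> real) \<Rightarrow> (nat \<Rightarrow> real)" where
  "soft_threshold n t y = (\<lambda>i\<in>{1..n}. sgn (y i) * max (\<bar>y i\<bar> - t) 0)"

text \<open>The squared error has polynomial growth in the Gaussian noise, so it is integrable and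
  the Bochner integral is the genuine expectation.\<close>

definition soft_risk :: "nat \<Rightarrow> real \<Rightarrow> real \<Rightarrow> (nat \<Rightarrow> real) \<Rightarrow> real" where
  "soft_risk n \<sigma> t \<theta> =
     (\<integral>z. l2_norm_sq n (\<lambda>i. soft_threshold n t (observation n \<sigma> \<theta> z) i - \<theta> i) \<partial>gauss_noise n)"

text \<open>Supremum and infimum are taken in \<^typ>\<open>ereal\<close>, where both always exist.\<close>

definition optimal_soft_risk :: "nat \<Rightarrow> nat \<Rightarrow> real \<Rightarrow> real \<Rightarrow> ereal" where
  "optimal_soft_risk n k \<tau> \<sigma> =
     (INF t\<in>{0..}. SUP \<theta>\<in>sparse_space n k \<tau>. ereal (soft_risk n \<sigma> t \<theta>))"

end

(* The risk of soft thresholding splits into scalar risks r(l, m), which satisfy r(l, m) <= 1 + l^2,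
   r(l, m) >= min(l, a)^2 - 3 when m >= 2a, and r(l, 0) of order exp(-l^2/2) / l^3. With
   eps = exp(-nu^2/2), the minimax risk per nonzero coordinate is therefore, up to O(1), the minimum
   over l of l^2 + exp(nu^2/2) exp(-l^2/2) / nu^3. The choice l^2 = nu^2 - 6 ln nu attains
   nu^2 - 6 ln nu + O(1), and exp x >= 2x shows that no l does better. *)

theory Submission
  imports Defs "HOL-Real_Asymp.Real_Asymp"
begin

section \<open>Scalar soft thresholding and pointwise error bounds\<close>

abbreviation std_gauss :: "real measure" where
  "std_gauss \<equiv> density lborel std_normal_density"

definition soft :: "real \<Rightarrow> real \<Rightarrow> real" where
  "soft l y = sgn y * max (\<bar>y\<bar> - l) 0"

definition scalar_risk :: "real \<Rightarrow> real \<Rightarrow> real" where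
  "scalar_risk l m = (\<integral>z. (soft l (m + z) - m)\<^sup>2 \<partial>std_gauss)"

lemma measurable_soft [measurable]: "soft l \<in> borel_measurable borel"
  unfolding soft_def by measurable

text \<open>Homogeneity of thresholding: this is what reduces noise level \<open>s\<close> with
  threshold \<open>t\<close> to noise level one with threshold \<open>t / s\<close>.\<close>

lemma soft_scale:
  assumes "s > 0"
  shows "soft t (s * y) = s * soft (t / s) y"
proof -
  have "max (\<bar>s * y\<bar> - t) 0 = s * max (\<bar>y\<bar> - t / s) 0"
    using assms by (auto simp: max_def abs_mult field_simps)
  then show ?thesis
    using assms by (simp add: soft_def sgn_mult)
qed

text \<open>The residual \<open>y - soft l y\<close> is the clipping of \<open>y\<close> to \<open>[-l, l]\<close>, hence monotone, so its
  correlation with the noise is nonnegative.\<close>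

lemma soft_error_le:
  assumes "l \<ge> 0"
  shows "(soft l (m + z) - m)\<^sup>2 \<le> z\<^sup>2 - 2 * max (- l) (min l m) * z + l\<^sup>2"
proof -
  define g where "g y = max (- l) (min l y)" for y
  have eq: "soft l y = y - g y" for y
    using assms by (auto simp: soft_def g_def sgn_if max_def min_def)
  have "z * g m \<le> z * g (m + z)"
  proof (cases "z \<ge> 0")
    case True
    then show ?thesis
      by (intro mult_left_mono) (auto simp: g_def max_def min_def)
  next
    case False
    then show ?thesis
      by (intro mult_left_mono_neg) (auto simp: g_def max_def min_def)
  qed
  moreover have "(g (m + z))\<^sup>2 \<le> l\<^sup>2"
    using assms by (intro power2_le_iff_abs_le[THEN iffD2]) (auto simp: g_def)
  ultimately have "(z - g (m + z))\<^sup>2 \<le> z\<^sup>2 - 2 * g m * z + l\<^sup>2"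
    by (simp add: power2_eq_square algebra_simps)
  then show ?thesis
    by (simp add: eq g_def[symmetric])
qed

text \<open>Thresholding at \<open>l >= a\<close> pulls an observation of size at least
  \<open>a\<close> down by at least \<open>a\<close>, so the error is at least \<open>a - z\<close>
  in absolute value when \<open>0 <= a - z <= m\<close>. For other \<open>z\<close> the left side is
  nonpositive: \<open>z > a\<close> gives \<open>(a - z)^2 <= z^2\<close>, and
  \<open>z < a - m\<close> gives \<open>z < - a\<close> because \<open>2 * a <= m\<close>, hence
  \<open>(a - z)^2 <= 4 * z^2\<close>.\<close>

lemma soft_error_ge:
  assumes "0 \<le> a" "a \<le> l" "2 * a \<le> m"
  shows "(a - z)\<^sup>2 - 4 * z\<^sup>2 \<le> (soft l (m + z) - m)\<^sup>2"
proof -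
  consider "z > a" | "z < a - m" | "0 \<le> a - z" "a - z \<le> m" by linarith
  then show ?thesis
  proof cases
    case 1
    then have "(z - a)\<^sup>2 \<le> z\<^sup>2"
      using assms by (intro power_mono) auto
    then have "(a - z)\<^sup>2 \<le> 4 * z\<^sup>2"
      using zero_le_power2[of z] by (simp only: power2_commute[of a z])
    then show ?thesis
      by (smt (verit) zero_le_power2)
  next
    case 2
    then have "(a - z)\<^sup>2 \<le> (2 * - z)\<^sup>2"
      using assms by (intro power_mono) auto
    then show ?thesis
      by (smt (verit) zero_le_power2 power_mult_distrib power2_minus four_x_squared)
  next
    case 3
    have "a - z \<le> m - soft l (m + z)"
      using assms 3 by (auto simp: soft_def sgn_if max_def)
    then have "(a - z)\<^sup>2 \<le> (m - soft l (m + z))\<^sup>2"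
      using 3 by (intro power_mono) auto
    then show ?thesis
      by (simp add: power2_commute[of m]) (smt (verit) zero_le_power2)
  qed
qed

section \<open>Gaussian moments and scalar risk at a general mean\<close>

lemma std_gauss_moments:
  shows "has_bochner_integral std_gauss (\<lambda>z. 1) (1::real)"
    and "has_bochner_integral std_gauss (\<lambda>z. z) 0"
    and "has_bochner_integral std_gauss (\<lambda>z. z\<^sup>2) 1"
proof -
  have "has_bochner_integral lborel (\<lambda>x. std_normal_density x * x ^ (2 * 0)) 1"
    using std_normal_moment_even[of 0] by simp
  then show "has_bochner_integral std_gauss (\<lambda>z. 1) (1::real)"
    by (intro has_bochner_integral_density) auto
  have "has_bochner_integral lborel (\<lambda>x. std_normal_density x * x ^ (2 * 0 + 1)) 0"
    using std_normal_moment_odd[of 0] by simp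
  then show "has_bochner_integral std_gauss (\<lambda>z. z) 0"
    by (intro has_bochner_integral_density) auto
  have "has_bochner_integral lborel (\<lambda>x. std_normal_density x * x ^ (2 * 1)) 1"
    using std_normal_moment_even[of 1] by (simp add: numeral_2_eq_2)
  then show "has_bochner_integral std_gauss (\<lambda>z. z\<^sup>2) 1"
    by (intro has_bochner_integral_density) auto
qed

text \<open>Both pointwise error bounds are quadratic polynomials in the noise, so this one
  evaluation turns them into risk bounds.\<close>

lemma std_gauss_quadratic:
  "has_bochner_integral std_gauss (\<lambda>z. a * z\<^sup>2 + b * z + c) (a + c)"
proof -
  have "has_bochner_integral std_gauss (\<lambda>z. a * z\<^sup>2 + b * z + c * 1) (a * 1 + b * 0 + c * 1)"
    by (intro has_bochner_integral_add has_bochner_integral_mult_right std_gauss_moments)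
  then show ?thesis by simp
qed

lemma integrable_soft_error:
  assumes "l \<ge> 0"
  shows "integrable std_gauss (\<lambda>z. (soft l (m + z) - m)\<^sup>2)"
proof (rule Bochner_Integration.integrable_bound)
  show "integrable std_gauss (\<lambda>z. 1 * z\<^sup>2 + (- 2 * max (- l) (min l m)) * z + l\<^sup>2)"
    using std_gauss_quadratic by (rule integrable.intros)
  show "AE z in std_gauss. norm ((soft l (m + z) - m)\<^sup>2)
      \<le> norm (1 * z\<^sup>2 + (- 2 * max (- l) (min l m)) * z + l\<^sup>2)"
    using soft_error_le[OF assms, of m] by (intro AE_I2) (smt (verit) mult_minus_left mult_1 real_norm_def zero_le_power2)
qed measurable

text \<open>The mean \<open>m\<close> enters the pointwise bound only through the coefficient of
  \<open>z\<close>, which integrates to zero; the bound is therefore uniform in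
  \<open>m\<close>.\<close>

lemma scalar_risk_le:
  assumes "l \<ge> 0"
  shows "scalar_risk l m \<le> 1 + l\<^sup>2"
proof -
  have "scalar_risk l m \<le> (\<integral>z. 1 * z\<^sup>2 + (- 2 * max (- l) (min l m)) * z + l\<^sup>2 \<partial>std_gauss)"
    unfolding scalar_risk_def
    using soft_error_le[OF assms, of m]
    by (intro integral_mono integrable_soft_error assms integrable.intros[OF std_gauss_quadratic]) auto
  also have "\<dots> = 1 + l\<^sup>2"
    using std_gauss_quadratic by (rule has_bochner_integral_integral_eq)
  finally show ?thesis .
qed

lemma scalar_risk_nonneg: "scalar_risk l m \<ge> 0"
  unfolding scalar_risk_def by simp

text \<open>The pointwise lower bound has mean \<open>(1 + a^2) - 4\<close>. The free parameter
  \<open>a\<close> is a guaranteed bias; it will be the smaller of the threshold and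
  \<open>\<nu>\<close>.\<close>

lemma scalar_risk_ge:
  assumes "0 \<le> a" "a \<le> l" "2 * a \<le> m"
  shows "a\<^sup>2 - 3 \<le> scalar_risk l m"
proof -
  have "(- 3) + a\<^sup>2 = (\<integral>z. (- 3) * z\<^sup>2 + (- 2 * a) * z + a\<^sup>2 \<partial>std_gauss)"
    using std_gauss_quadratic by (rule has_bochner_integral_integral_eq[symmetric])
  also have "\<dots> \<le> scalar_risk l m"
    unfolding scalar_risk_def
  proof (intro integral_mono integrable_soft_error integrable.intros[OF std_gauss_quadratic])
    show "l \<ge> 0" using assms by simp
    fix z :: real
    show "(- 3) * z\<^sup>2 + (- 2 * a) * z + a\<^sup>2 \<le> (soft l (m + z) - m)\<^sup>2"
      using soft_error_ge[OF assms, of z] by (simp add: power2_eq_square algebra_simps)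
  qed
  finally show ?thesis by simp
qed

section \<open>Scalar risk at mean zero: tail bounds of matching order\<close>

lemma scalar_risk_zero:
  "scalar_risk l 0 = (\<integral>z. std_normal_density z * (max (\<bar>z\<bar> - l) 0)\<^sup>2 \<partial>lborel)" (is ?eq)
  and integrable_scalar_risk_zero:
  "l \<ge> 0 \<Longrightarrow> integrable lborel (\<lambda>z. std_normal_density z * (max (\<bar>z\<bar> - l) 0)\<^sup>2)" (is "_ \<Longrightarrow> ?int")
proof -
  have sq: "std_normal_density z * (max (\<bar>z\<bar> - l) 0)\<^sup>2 = std_normal_density z * (soft l z)\<^sup>2"
    if "l \<ge> 0 \<or> z \<noteq> 0" for z
    using that by (auto simp: soft_def power_mult_distrib sgn_if)
  \<comment> \<open>For negative \<open>l\<close> the pointwise identity fails at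
    \<open>z = 0\<close>, where \<open>sgn\<close> vanishes; that point is a null set.\<close>
  have ae: "AE z in lborel. z \<noteq> (0::real)"
    by (rule AE_lborel_singleton)
  show ?eq
    unfolding scalar_risk_def
    by (subst integral_density) (auto intro!: integral_cong_AE eventually_mono[OF ae] simp: sq)
  show ?int if "l \<ge> 0"
    using integrable_soft_error[OF that, of 0] that
    by (subst (asm) integrable_density) (auto simp: sq)
qed

text \<open>Completing the square bounds the normal density at \<open>l + u\<close>, for
  \<open>u >= 0\<close>, by its value at \<open>l\<close> times \<open>exp (- l * u)\<close>. Each
  tail then costs at most that value times the integral of \<open>u^2 * exp (- l * u)\<close>, which
  is \<open>2 / l^3\<close>. The integral is read off the total mass of
  \<open>erlang_density 2 l\<close>, the Gamma density of shape 3 and rate \<open>l\<close>.\<close>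

lemma scalar_risk_zero_le:
  assumes "l > 0"
  shows "scalar_risk l 0 \<le> 4 * exp (- l\<^sup>2 / 2) / l ^ 3"
proof -
  \<comment> \<open>Undoes the Erlang normalisation: for \<open>u >= 0\<close>,
    \<open>c * erlang_density 2 l u\<close> equals
    \<open>std_normal_density l * u^2 * exp (- l * u)\<close>.\<close>
  define c where "c = std_normal_density l * 2 / l ^ 3"
  have dens: "has_bochner_integral lborel (erlang_density 2 l) 1"
  proof -
    interpret prob_space "density lborel (erlang_density 2 l)"
      using assms by (rule prob_space_erlang_density)
    have "(\<integral>\<^sup>+x. ennreal (erlang_density 2 l x) \<partial>lborel) = ennreal 1"
      using emeasure_space_1 by (simp add: emeasure_density)
    then show ?thesis
      by (intro has_bochner_integral_nn_integral) (use assms in \<open>auto simp: erlang_density_def\<close>)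
  qed
  \<comment> \<open>The shifted copy dominates the tail beyond \<open>l\<close>, the reflected copy
    the tail below \<open>- l\<close>.\<close>
  have shifted: "has_bochner_integral lborel (\<lambda>x. erlang_density 2 l (- l + 1 * x)) 1"
    using lborel_has_bochner_integral_real_affine_iff[of 1 "erlang_density 2 l" 1 "- l"] dens by simp
  have reflected: "has_bochner_integral lborel (\<lambda>x. erlang_density 2 l (- l + (- 1) * x)) 1"
    using lborel_has_bochner_integral_real_affine_iff[of "- 1" "erlang_density 2 l" 1 "- l"] dens by simp
  have bound: "has_bochner_integral lborel
      (\<lambda>x. c * (erlang_density 2 l (- l + 1 * x) + erlang_density 2 l (- l + (- 1) * x))) (c * (1 + 1))"
    by (intro has_bochner_integral_mult_right has_bochner_integral_add shifted reflected)
  have one_sided: "std_normal_density x * (max (x - l) 0)\<^sup>2 \<le> c * erlang_density 2 l (x - l)" for x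
  proof (cases "x \<ge> l")
    case True
    have "- x\<^sup>2 / 2 \<le> - l\<^sup>2 / 2 + - l * (x - l)"
      using zero_le_power2[of "x - l"] by (simp add: power2_eq_square field_simps)
    then have "exp (- x\<^sup>2 / 2) \<le> exp (- l\<^sup>2 / 2) * exp (- l * (x - l))"
      by (simp flip: exp_add)
    then have "std_normal_density x * (x - l)\<^sup>2
        \<le> std_normal_density l * exp (- l * (x - l)) * (x - l)\<^sup>2"
      unfolding std_normal_density_def
      by (intro mult_right_mono) (auto simp: field_simps)
    also have "\<dots> = c * erlang_density 2 l (x - l)"
      using assms True by (simp add: c_def erlang_density_def field_simps eval_nat_numeral)
    finally show ?thesis using True by (simp add: max_absorb1)
  next
    case False
    then show ?thesis by (simp add: erlang_density_def)
  qed
  have cnn: "c \<ge> 0" using assms by (simp add: c_def)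
  have "scalar_risk l 0 \<le> c * (1 + 1)"
    unfolding scalar_risk_zero has_bochner_integral_integral_eq[OF bound, symmetric]
  proof (intro integral_mono integrable_scalar_risk_zero integrable.intros[OF bound])
    show "l \<ge> 0" using assms by simp
    fix x :: real
    have e0: "erlang_density 2 l y \<ge> 0" for y
      using assms by (simp add: erlang_density_def)
    show "std_normal_density x * (max (\<bar>x\<bar> - l) 0)\<^sup>2
      \<le> c * (erlang_density 2 l (- l + 1 * x) + erlang_density 2 l (- l + (- 1) * x))"
    proof (cases "x \<ge> 0")
      case True
      then show ?thesis
        using one_sided[of x] mult_nonneg_nonneg[OF cnn e0[of "- l - x"]]
        by (auto simp: distrib_left)
    next
      case False
      then show ?thesis
        using one_sided[of "- x"] mult_nonneg_nonneg[OF cnn e0[of "- l + x"]]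
        by (simp add: distrib_left std_normal_density_def minus_diff_commute[of l])
    qed
  qed
  also have "\<dots> = 4 * (1 / sqrt (2 * pi)) * exp (- l\<^sup>2 / 2) / l ^ 3"
    by (simp add: c_def std_normal_density_def)
  also have "\<dots> \<le> 4 * 1 * exp (- l\<^sup>2 / 2) / l ^ 3"
  proof -
    have "1 \<le> sqrt (2 * pi)" using pi_ge_two by simp
    then have "1 / sqrt (2 * pi) \<le> 1" by simp
    then show ?thesis
      using assms by (intro divide_right_mono mult_right_mono mult_left_mono) auto
  qed
  finally show ?thesis by simp
qed

text \<open>The factor \<open>exp (- 3 / 2)\<close> is the loss of density across the window used
  below, \<open>1 / 8\<close> is the cube of the half in \<open>h / 2\<close>, and
  \<open>sqrt (2 * pi)\<close> normalises the density.\<close>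

definition tail_const :: real where
  "tail_const = exp (- 3 / 2) / (8 * sqrt (2 * pi))"

lemma tail_const_pos: "tail_const > 0"
  by (simp add: tail_const_def)

lemma tail_const_le_1: "tail_const \<le> 1"
proof -
  have "exp (- 3 / 2) \<le> (1::real)" by simp
  also have "1 \<le> 8 * sqrt (2 * pi)"
    using pi_ge_two real_sqrt_ge_one[of "2 * pi"] by linarith
  finally show ?thesis by (simp add: tail_const_def)
qed

text \<open>Only the noise values at distance between \<open>h/2\<close> and \<open>h = 1/(1+l)\<close> above the threshold are
  kept; there the density is comparable to its value at \<open>l\<close>.\<close>

lemma scalar_risk_zero_ge:
  assumes "l \<ge> 0"
  shows "tail_const * exp (- l\<^sup>2 / 2) / (1 + l) ^ 3 \<le> scalar_risk l 0"
proof -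
  define h where "h = 1 / (1 + l)"
  \<comment> \<open>A lower bound for the integrand on the window: the excess over \<open>l\<close>
    is at least \<open>h / 2\<close>, and moving from \<open>l\<close> to \<open>l + u\<close> adds
    \<open>l * u + u^2 / 2 <= 3 / 2\<close> to the negative exponent.\<close>
  define c where "c = std_normal_density l * exp (- 3 / 2) * (h / 2)\<^sup>2"
  have h: "h > 0" "h \<le> 1" "l * h \<le> 1"
    using assms by (auto simp: h_def field_simps)
  have bound: "has_bochner_integral lborel (\<lambda>x. c * indicator {l + h / 2..l + h} x) (c * (h / 2))"
    using h has_bochner_integral_real_indicator[of "{l + h / 2..l + h}" lborel]
    by (intro has_bochner_integral_mult_right) simp
  have "c * (h / 2) \<le> scalar_risk l 0"
    unfolding scalar_risk_zero has_bochner_integral_integral_eq[OF bound, symmetric]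
  proof (intro integral_mono integrable_scalar_risk_zero integrable.intros[OF bound] assms)
    fix x :: real
    show "c * indicator {l + h / 2..l + h} x \<le> std_normal_density x * (max (\<bar>x\<bar> - l) 0)\<^sup>2"
    proof (cases "x \<in> {l + h / 2..l + h}")
      case True
      define u where "u = x - l"
      have u: "h / 2 \<le> u" "u \<le> h" "x = l + u" using True by (auto simp: u_def)
      have "l * u \<le> 1"
        using mult_left_mono[OF u(2) assms] h by simp
      moreover have "u\<^sup>2 \<le> 1"
        using u h by (simp add: power_le_one)
      ultimately have "- l\<^sup>2 / 2 + - 3 / 2 \<le> - x\<^sup>2 / 2"
        by (simp add: u(3) power2_eq_square field_simps)
      then have "exp (- l\<^sup>2 / 2) * exp (- 3 / 2) \<le> exp (- x\<^sup>2 / 2)"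
        by (simp flip: exp_add)
      then have "std_normal_density l * exp (- 3 / 2) \<le> std_normal_density x"
        by (simp add: std_normal_density_def field_simps)
      moreover have "(h / 2)\<^sup>2 \<le> u\<^sup>2"
        using u h by (intro power_mono) auto
      ultimately have "c \<le> std_normal_density x * u\<^sup>2"
        unfolding c_def by (intro mult_mono) auto
      then show ?thesis
        using True u h assms by (simp add: max_def)
    next
      case False
      then show ?thesis by simp
    qed
  qed
  moreover have "c * (h / 2) = tail_const * exp (- l\<^sup>2 / 2) / (1 + l) ^ 3"
    by (simp add: c_def h_def tail_const_def std_normal_density_def field_simps) (simp add: algebra_simps power_numeral_reduce)
  ultimately show ?thesis by (simp only:)
qed

section \<open>From vector risk to scalar risks\<close>

text \<open>The squared error is a sum of terms that each see one noise coordinate, whose marginal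
  is \<open>std_gauss\<close>; linearity of the integral does the rest, and rescaling each error
  contributes \<open>s^2\<close>.\<close>

lemma soft_risk_eq:
  assumes "s > 0" "t \<ge> 0"
  shows "soft_risk n s t \<theta> = s\<^sup>2 * (\<Sum>i\<in>{1..n}. scalar_risk (t / s) (\<theta> i / s))"
proof -
  have prob: "prob_space std_gauss"
    using prob_space_normal_density[of 1 0] by simp
  define M where "M = (\<lambda>_::nat. std_gauss)"
  interpret product_prob_space M "{1..n}"
    unfolding M_def
    by (intro product_prob_spaceI prob)
  define f where "f i z = (soft (t / s) (\<theta> i / s + z) - \<theta> i / s)\<^sup>2" for i z
  have fm [measurable]: "f i \<in> borel_measurable borel" for i
    unfolding f_def by measurable
  have fM: "f i \<in> borel_measurable (M i)" for i
    by (simp add: M_def)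
  have int: "integrable (M i) (f i)" for i
    unfolding M_def f_def using assms by (intro integrable_soft_error) simp
  have comp: "integrable (Pi\<^sub>M {1..n} M) (\<lambda>z. f i (z i))"
    "(\<integral>z. f i (z i) \<partial>Pi\<^sub>M {1..n} M) = (\<integral>z. f i z \<partial>M i)" if "i \<in> {1..n}" for i
  proof -
    have d: "distr (Pi\<^sub>M {1..n} M) (M i) (\<lambda>z. z i) = M i"
      using that by (rule PiM_component)
    have m: "(\<lambda>z. z i) \<in> measurable (Pi\<^sub>M {1..n} M) (M i)"
      using that by (rule measurable_component_singleton)
    show "integrable (Pi\<^sub>M {1..n} M) (\<lambda>z. f i (z i))"
      using integrable_distr_eq[OF m fM] int[of i] d by simp
    show "(\<integral>z. f i (z i) \<partial>Pi\<^sub>M {1..n} M) = (\<integral>z. f i z \<partial>M i)"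
      using integral_distr[OF m fM] d by simp
  qed
  have pointwise: "l2_norm_sq n (\<lambda>i. soft_threshold n t (observation n s \<theta> z) i - \<theta> i)
      = s\<^sup>2 * (\<Sum>i\<in>{1..n}. f i (z i))" for z
  proof -
    have "soft_threshold n t (observation n s \<theta> z) i - \<theta> i
        = s * (soft (t / s) (\<theta> i / s + z i) - \<theta> i / s)" if "i \<in> {1..n}" for i
    proof -
      have "soft_threshold n t (observation n s \<theta> z) i = soft t (s * (\<theta> i / s + z i))"
        using that assms by (simp add: soft_threshold_def observation_def soft_def distrib_left)
      then show ?thesis
        using assms by (simp add: soft_scale right_diff_distrib)
    qed
    then show ?thesis
      unfolding l2_norm_sq_def sum_distrib_left
      by (intro sum.cong) (auto simp: f_def power_mult_distrib)
  qed
  have "soft_risk n s t \<theta> = s\<^sup>2 * (\<Sum>i\<in>{1..n}. \<integral>z. f i (z i) \<partial>Pi\<^sub>M {1..n} M)"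
    unfolding soft_risk_def pointwise gauss_noise_def M_def[symmetric]
    by (simp only: integral_mult_right_zero Bochner_Integration.integral_sum comp)
  also have "(\<Sum>i\<in>{1..n}. \<integral>z. f i (z i) \<partial>Pi\<^sub>M {1..n} M)
      = (\<Sum>i\<in>{1..n}. scalar_risk (t / s) (\<theta> i / s))"
    by (intro sum.cong refl) (simp only: comp, simp only: M_def f_def scalar_risk_def)
  finally show ?thesis .
qed

text \<open>At most \<open>k\<close> coordinates are charged the uniform bound
  \<open>1 + l^2\<close>. The zero-mean risk is charged to every coordinate, nonzero ones included,
  which gives the factor \<open>n\<close> in place of the number of zeros.\<close>

lemma soft_risk_le:
  assumes "s > 0" "l \<ge> 0" "\<theta> \<in> sparse_space n k \<tau>"
  shows "soft_risk n s (s * l) \<theta> \<le> s\<^sup>2 * (real k * (1 + l\<^sup>2) + real n * scalar_risk l 0)"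
proof -
  let ?S = "{i \<in> {1..n}. \<theta> i \<noteq> 0}"
  have "(\<Sum>i\<in>{1..n}. scalar_risk l (\<theta> i / s))
      \<le> (\<Sum>i\<in>{1..n}. (if \<theta> i \<noteq> 0 then 1 + l\<^sup>2 else 0) + scalar_risk l 0)"
    using scalar_risk_le[OF assms(2)] scalar_risk_nonneg[of l 0]
    by (intro sum_mono) (auto intro: add_increasing2)
  also have "\<dots> = real (card ?S) * (1 + l\<^sup>2) + real n * scalar_risk l 0"
    by (simp add: sum.distrib sum.inter_filter[symmetric])
  also have "\<dots> \<le> real k * (1 + l\<^sup>2) + real n * scalar_risk l 0"
    using assms(3) by (intro add_right_mono mult_right_mono) (auto simp: sparse_space_def l0_norm_def)
  finally show ?thesis
    using assms by (subst soft_risk_eq) auto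
qed

lemma SUP_soft_risk_ge:
  assumes "s > 0" "l \<ge> 0" "k \<le> n"
  shows "(SUP \<theta>\<in>sparse_space n k \<tau>. ereal (soft_risk n s (s * l) \<theta>))
    \<ge> ereal (s\<^sup>2 * (real k * scalar_risk l (\<tau> / s) + (real n - real k) * scalar_risk l 0))"
proof -
  \<comment> \<open>An unfavourable vector: the energy budget is spread evenly over \<open>k\<close>
    coordinates, so the norm constraint holds with equality.\<close>
  define \<theta> where "\<theta> = (\<lambda>i\<in>{1..n}. if i \<le> k then \<tau> else 0)"
  have sub: "{1..n} \<inter> {i. i \<le> k} = {1..k}" "{1..n} \<inter> - {i. i \<le> k} = {k<..n}"
    using assms by auto
  have "l0_norm n \<theta> \<le> card {1..k}"
    unfolding l0_norm_def by (rule card_mono) (auto simp: \<theta>_def split: if_splits)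
  moreover have "l2_norm_sq n \<theta> = (\<Sum>i\<in>{1..n}. if i \<le> k then \<tau>\<^sup>2 else 0)"
    unfolding l2_norm_sq_def by (intro sum.cong) (auto simp: \<theta>_def)
  then have "l2_norm_sq n \<theta> = real k * \<tau>\<^sup>2"
    by (simp only: sum.If_cases[OF finite_atLeastAtMost] sub) simp
  ultimately have "\<theta> \<in> sparse_space n k \<tau>"
    by (auto simp: sparse_space_def \<theta>_def)
  moreover have "(\<Sum>i\<in>{1..n}. scalar_risk l (\<theta> i / s))
      = (\<Sum>i\<in>{1..n}. if i \<le> k then scalar_risk l (\<tau> / s) else scalar_risk l 0)"
    by (intro sum.cong) (auto simp: \<theta>_def)
  then have "soft_risk n s (s * l) \<theta>
      = s\<^sup>2 * (real k * scalar_risk l (\<tau> / s) + (real n - real k) * scalar_risk l 0)"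
    using assms
    by (subst soft_risk_eq)
      (simp_all add: sum.If_cases sub[unfolded One_nat_def] of_nat_diff)
  ultimately show ?thesis
    by (metis (no_types, lifting) SUP_upper)
qed

section \<open>Upper bound for the optimal risk\<close>

text \<open>The squared threshold \<open>\<nu>\<^sup>2 - 6 ln \<nu>\<close> makes the total risk of the zero coordinates of
  order \<open>k\<close>.\<close>

lemma optimal_soft_risk_le:
  assumes "s > 0" "1 \<le> k" "k \<le> n" "\<nu> \<ge> 1" "6 * ln \<nu> \<le> 3 / 4 * \<nu>\<^sup>2"
    and eps: "exp (- \<nu>\<^sup>2 / 2) = real k / real n"
  shows "optimal_soft_risk n k \<tau> s \<le> ereal (s\<^sup>2 * real k * (\<nu>\<^sup>2 - 6 * ln \<nu> + 33))"
proof -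
  define l where "l = sqrt (\<nu>\<^sup>2 - 6 * ln \<nu>)"
  have l2: "l\<^sup>2 = \<nu>\<^sup>2 - 6 * ln \<nu>"
    using assms(5) zero_le_power2[of \<nu>] unfolding l_def by (intro real_sqrt_pow2) linarith
  \<comment> \<open>The growth hypothesis keeps \<open>l\<close> at least \<open>\<nu> / 2\<close>,
    so \<open>l^3\<close> and \<open>\<nu>^3\<close> agree up to a factor 8.\<close>
  have "(\<nu> / 2)\<^sup>2 \<le> \<nu>\<^sup>2 - 6 * ln \<nu>"
    using assms(5) by (simp add: power2_eq_square)
  then have l: "\<nu> / 2 \<le> l"
    unfolding l_def by (rule real_le_rsqrt)
  then have "l > 0" using assms(4) by linarith
  \<comment> \<open>The correction \<open>- 6 * ln \<nu>\<close> produces exactly the factor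
    \<open>\<nu>^3\<close> that offsets the \<open>l^3\<close> in the tail bound. The zero
    coordinates then cost at most \<open>32 * k\<close>, where 32 is \<open>4 * 8\<close>; one more
    per nonzero coordinate gives 33.\<close>
  have "exp (- l\<^sup>2 / 2) = exp (- \<nu>\<^sup>2 / 2) * exp (3 * ln \<nu>)"
    by (simp add: l2 flip: exp_add)
  also have "exp (3 * ln \<nu>) = \<nu> ^ 3"
    using assms(4) exp_of_nat_mult[of 3 "ln \<nu>"] by simp
  finally have e: "exp (- l\<^sup>2 / 2) = real k / real n * \<nu> ^ 3"
    by (simp only: eps)
  have "(\<nu> / 2) ^ 3 \<le> l ^ 3"
    using l assms(4) by (intro power_mono) auto
  then have "4 * \<nu> ^ 3 / l ^ 3 \<le> 32"
    using \<open>l > 0\<close> by (simp add: field_simps)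
  then have "real k * (4 * \<nu> ^ 3 / l ^ 3) \<le> real k * 32"
    by (rule mult_left_mono) simp
  moreover have "real n * scalar_risk l 0 \<le> real n * (4 * exp (- l\<^sup>2 / 2) / l ^ 3)"
    by (intro mult_left_mono scalar_risk_zero_le \<open>l > 0\<close>) simp
  moreover have "real n * (4 * exp (- l\<^sup>2 / 2) / l ^ 3) = real k * (4 * \<nu> ^ 3 / l ^ 3)"
    using assms(2,3) by (simp only: e) simp
  ultimately have "real n * scalar_risk l 0 \<le> real k * 32" by linarith
  then have "real k * (1 + l\<^sup>2) + real n * scalar_risk l 0 \<le> real k * (\<nu>\<^sup>2 - 6 * ln \<nu> + 33)"
    by (simp add: l2 algebra_simps)
  then have *: "s\<^sup>2 * (real k * (1 + l\<^sup>2) + real n * scalar_risk l 0)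
      \<le> s\<^sup>2 * real k * (\<nu>\<^sup>2 - 6 * ln \<nu> + 33)"
    by (simp add: mult.assoc mult_left_mono)
  show ?thesis
    unfolding optimal_soft_risk_def
  proof (rule INF_lower2[of "s * l"])
    show "s * l \<in> {0..}" using assms(1) \<open>l > 0\<close> by simp
    show "(SUP \<theta>\<in>sparse_space n k \<tau>. ereal (soft_risk n s (s * l) \<theta>))
        \<le> ereal (s\<^sup>2 * real k * (\<nu>\<^sup>2 - 6 * ln \<nu> + 33))"
    proof (rule SUP_least)
      fix \<theta> assume "\<theta> \<in> sparse_space n k \<tau>"
      from soft_risk_le[OF assms(1) _ this, of l] * \<open>l > 0\<close>
      show "ereal (soft_risk n s (s * l) \<theta>) \<le> ereal (s\<^sup>2 * real k * (\<nu>\<^sup>2 - 6 * ln \<nu> + 33))"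
        by simp
    qed
  qed
qed

section \<open>Lower bound for every threshold\<close>

text \<open>Slope 2 is chosen for \<open>x = ln A - l^2 / 2\<close>: it yields
  \<open>l^2 + A * exp (- l^2 / 2) >= 2 * ln A\<close>, whose right side is free of
  \<open>l\<close>.\<close>

lemma exp_ge_double: "2 * x \<le> exp x" for x :: real
proof (cases "x \<ge> 0")
  case True
  have "2 * x \<le> (1 + x / 2)\<^sup>2"
    using zero_le_power2[of "1 - x / 2"] by (simp add: power2_eq_square field_simps)
  also have "\<dots> \<le> (exp (x / 2))\<^sup>2"
    using True by (intro power_mono exp_ge_add_one_self) auto
  also have "\<dots> = exp x"
    by (simp flip: exp_double)
  finally show ?thesis .
next
  case False
  then show ?thesis
    using exp_gt_zero[of x] by linarith
qed

text \<open>For \<open>l >= \<nu>\<close> the bias of the nonzero coordinates alone suffices; for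
  smaller \<open>l\<close> it is traded against the false positives among the zeros. In the
  constant, \<open>tail_const\<close> is halved because \<open>n - k >= n / 2\<close>,
  \<open>6 * ln 2\<close> comes from \<open>1 + \<nu> <= 2 * \<nu>\<close>, and 3 is the loss in
  \<open>scalar_risk_ge\<close>.\<close>

lemma scalar_risks_ge:
  assumes "l \<ge> 0" "1 \<le> k" "2 * k \<le> n" "\<nu> \<ge> 1" "2 * \<nu> \<le> m"
    and eps: "exp (- \<nu>\<^sup>2 / 2) = real k / real n"
  shows "real k * (\<nu>\<^sup>2 - 6 * ln \<nu> + (2 * ln (tail_const / 2) - 6 * ln 2 - 3))
    \<le> real k * scalar_risk l m + (real n - real k) * scalar_risk l 0"
proof (cases "l \<ge> \<nu>")
  case True
  have "\<nu>\<^sup>2 - 3 \<le> scalar_risk l m"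
    using assms True by (intro scalar_risk_ge) auto
  moreover have "ln (tail_const / 2) \<le> 0"
    using tail_const_pos tail_const_le_1 by simp
  moreover have "ln \<nu> \<ge> 0" "ln (2::real) \<ge> 0"
    using assms(4) by auto
  ultimately have "\<nu>\<^sup>2 - 6 * ln \<nu> + (2 * ln (tail_const / 2) - 6 * ln 2 - 3) \<le> scalar_risk l m"
    by linarith
  then have "real k * (\<nu>\<^sup>2 - 6 * ln \<nu> + (2 * ln (tail_const / 2) - 6 * ln 2 - 3))
      \<le> real k * scalar_risk l m"
    by (rule mult_left_mono) simp
  moreover have "0 \<le> (real n - real k) * scalar_risk l 0"
    using assms(3) by (intro mult_nonneg_nonneg scalar_risk_nonneg) simp
  ultimately show ?thesis by linarith
next
  case False
  \<comment> \<open>Chosen so that \<open>k * A * exp (- l^2 / 2)\<close> bounds the risk of the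
    zero coordinates from below: \<open>exp (\<nu>^2 / 2)\<close> is \<open>n / k\<close>, and
    \<open>1 + \<nu>\<close> may replace \<open>1 + l\<close> since
    \<open>l < \<nu>\<close>.\<close>
  define A where "A = tail_const / 2 * exp (\<nu>\<^sup>2 / 2) / (1 + \<nu>) ^ 3"
  have A: "A > 0"
    using tail_const_pos assms(4) by (simp add: A_def)
  have lnA: "ln A = ln (tail_const / 2) + \<nu>\<^sup>2 / 2 - 3 * ln (1 + \<nu>)"
    using tail_const_pos assms(4)
    by (simp add: A_def ln_div ln_mult ln_realpow)
  have "ln (1 + \<nu>) \<le> ln (2 * \<nu>)"
    using assms(4) by simp
  also have "\<dots> = ln 2 + ln \<nu>"
    using assms(4) by (simp add: ln_mult)
  finally have "\<nu>\<^sup>2 - 6 * ln \<nu> + (2 * ln (tail_const / 2) - 6 * ln 2 - 3) \<le> 2 * ln A - 3"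
    by (simp add: lnA)
  also have "\<dots> \<le> l\<^sup>2 - 3 + A * exp (- l\<^sup>2 / 2)"
  proof -
    have "2 * (ln A + - l\<^sup>2 / 2) \<le> exp (ln A + - l\<^sup>2 / 2)"
      by (rule exp_ge_double)
    also have "\<dots> = A * exp (- l\<^sup>2 / 2)"
      using A by (simp only: exp_add exp_ln)
    finally show ?thesis by simp
  qed
  also have "\<dots> \<le> scalar_risk l m + A * exp (- l\<^sup>2 / 2)"
    using assms False by (intro add_right_mono scalar_risk_ge) auto
  finally have "real k * (\<nu>\<^sup>2 - 6 * ln \<nu> + (2 * ln (tail_const / 2) - 6 * ln 2 - 3))
      \<le> real k * (scalar_risk l m + A * exp (- l\<^sup>2 / 2))"
    by (rule mult_left_mono) simp
  also have "\<dots> = real k * scalar_risk l m + real k * A * exp (- l\<^sup>2 / 2)"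
    by (simp add: distrib_left)
  also have "real k * A * exp (- l\<^sup>2 / 2) \<le> (real n - real k) * scalar_risk l 0"
  proof -
    have "exp (\<nu>\<^sup>2 / 2) = inverse (exp (- \<nu>\<^sup>2 / 2))"
      by (simp add: exp_minus)
    then have "real k * exp (\<nu>\<^sup>2 / 2) = real n"
      using assms(2) by (simp only: eps) simp
    then have "real k * A * exp (- l\<^sup>2 / 2)
        = real n / 2 * (tail_const * exp (- l\<^sup>2 / 2) / (1 + \<nu>) ^ 3)"
      by (simp add: A_def field_simps)
    also have "\<dots> \<le> real n / 2 * (tail_const * exp (- l\<^sup>2 / 2) / (1 + l) ^ 3)"
      using False assms tail_const_pos
      by (intro mult_left_mono divide_left_mono power_mono mult_pos_pos zero_less_power) auto
    also have "\<dots> \<le> real n / 2 * scalar_risk l 0"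
      by (intro mult_left_mono scalar_risk_zero_ge assms(1)) simp
    also have "\<dots> \<le> (real n - real k) * scalar_risk l 0"
      using assms(3) by (intro mult_right_mono scalar_risk_nonneg) linarith
    finally show ?thesis .
  qed
  finally show ?thesis by simp
qed

lemma optimal_soft_risk_ge:
  assumes "s > 0" "1 \<le> k" "2 * k \<le> n" "\<nu> \<ge> 1" "2 * \<nu> \<le> \<tau> / s"
    and eps: "exp (- \<nu>\<^sup>2 / 2) = real k / real n"
  shows "ereal (s\<^sup>2 * real k * (\<nu>\<^sup>2 - 6 * ln \<nu> + (2 * ln (tail_const / 2) - 6 * ln 2 - 3)))
    \<le> optimal_soft_risk n k \<tau> s"
  unfolding optimal_soft_risk_def
proof (rule INF_greatest)
  fix t :: real assume "t \<in> {0..}"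
  then have l: "t / s \<ge> 0" "s * (t / s) = t" using assms(1) by auto
  have "ereal (s\<^sup>2 * real k * (\<nu>\<^sup>2 - 6 * ln \<nu> + (2 * ln (tail_const / 2) - 6 * ln 2 - 3)))
      \<le> ereal (s\<^sup>2 * (real k * scalar_risk (t / s) (\<tau> / s) + (real n - real k) * scalar_risk (t / s) 0))"
    using scalar_risks_ge[OF l(1) assms(2-5) eps]
    by (simp add: mult.assoc mult_left_mono)
  also have "\<dots> \<le> (SUP \<theta>\<in>sparse_space n k \<tau>. ereal (soft_risk n s t \<theta>))"
    using SUP_soft_risk_ge[OF assms(1) l(1), of k n \<tau>] assms(3) by (simp only: l(2))
  finally show "ereal (s\<^sup>2 * real k * (\<nu>\<^sup>2 - 6 * ln \<nu> + (2 * ln (tail_const / 2) - 6 * ln 2 - 3)))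
      \<le> (SUP \<theta>\<in>sparse_space n k \<tau>. ereal (soft_risk n s t \<theta>))" .
qed

section \<open>Asymptotics of the optimal risk\<close>

theorem proposition6:
  fixes k :: "nat \<Rightarrow> nat" and \<tau> \<sigma> :: "nat \<Rightarrow> real"
    and \<epsilon> \<mu> \<nu> :: "nat \<Rightarrow> real"
  defines "\<epsilon> \<equiv> \<lambda>n. real (k n) / real n"
    and "\<mu> \<equiv> \<lambda>n. \<tau> n / \<sigma> n"
    and "\<nu> \<equiv> \<lambda>n. sqrt (2 * ln (inverse (\<epsilon> n)))"
  assumes "\<And>n. n \<ge> 1 \<Longrightarrow> 1 \<le> k n \<and> k n \<le> n"
    and "\<And>n. n \<ge> 1 \<Longrightarrow> \<tau> n > 0"
    and "\<And>n. n \<ge> 1 \<Longrightarrow> \<sigma> n > 0"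
    and "\<epsilon> \<longlonglongrightarrow> 0"
    and "(\<lambda>n. sqrt (ln (inverse (\<epsilon> n))) / \<mu> n) \<longlonglongrightarrow> 0"
  shows "\<exists>r. r \<longlonglongrightarrow> 0 \<and>
    (\<forall>\<^sub>F n in sequentially.
      optimal_soft_risk n (k n) (\<tau> n) (\<sigma> n) =
        ereal (real n * (\<sigma> n)\<^sup>2 *
          (2 * \<epsilon> n * ln (inverse (\<epsilon> n)) - 6 * \<epsilon> n * ln (\<nu> n) * (1 + r n))))"
proof -
  define C where "C = max 33 \<bar>2 * ln (tail_const / 2) - 6 * ln 2 - 3\<bar>"
  \<comment> \<open>The risk per nonzero coordinate in units of the noise variance. The default 0 of
    \<open>real_of_ereal\<close> at infinite values is eventually irrelevant, as the two bounds
    force finiteness.\<close>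
  define R where "R n = real_of_ereal (optimal_soft_risk n (k n) (\<tau> n) (\<sigma> n))
    / ((\<sigma> n)\<^sup>2 * real (k n))" for n
  \<comment> \<open>Obtained by solving
    \<open>R n = (\<nu> n)^2 - 6 * ln (\<nu> n) * (1 + r n)\<close>. The numerator stays within
    \<open>C\<close>, which covers the constants of both bounds, while the denominator
    diverges.\<close>
  define r where "r n = ((\<nu> n)\<^sup>2 - 6 * ln (\<nu> n) - R n) / (6 * ln (\<nu> n))" for n
  have pos: "\<forall>\<^sub>F n in sequentially. \<epsilon> n > 0"
    using eventually_ge_at_top[of 1]
  proof eventually_elim
    case (elim n)
    with assms(4)[of n] show ?case by (simp add: \<epsilon>_def)
  qed
  have "filterlim \<epsilon> (at_right 0) sequentially"
    using assms(7) pos by (intro tendsto_imp_filterlim_at_right)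
  then have "filterlim (\<lambda>n. inverse (\<epsilon> n)) at_top sequentially"
    by (rule filterlim_compose[OF filterlim_inverse_at_top_right])
  then have L: "filterlim (\<lambda>n. ln (inverse (\<epsilon> n))) at_top sequentially"
    by (rule filterlim_compose[OF ln_at_top])
  have nu: "filterlim \<nu> at_top sequentially"
    unfolding \<nu>_def
    by (intro filterlim_compose[OF sqrt_at_top] filterlim_tendsto_pos_mult_at_top[OF tendsto_const _ L]) auto
  have growth: "\<forall>\<^sub>F x::real in at_top. 6 * ln x \<le> 3 / 4 * x\<^sup>2"
    by real_asymp
  \<comment> \<open>The bound \<open>1 / 2\<close> yields \<open>2 * k n <= n\<close>. The bound
    \<open>1 / 3\<close> in the next fact yields \<open>2 * \<nu> n <= \<mu> n\<close>, because
    \<open>2 * sqrt 2 <= 3\<close>.\<close>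
  have small1: "\<forall>\<^sub>F n in sequentially. \<epsilon> n < 1 / 2"
    using assms(7) by (rule order_tendstoD) simp
  have small2: "\<forall>\<^sub>F n in sequentially. sqrt (ln (inverse (\<epsilon> n))) / \<mu> n < 1 / 3"
    using assms(8) by (rule order_tendstoD) simp
  have key: "\<forall>\<^sub>F n in sequentially. optimal_soft_risk n (k n) (\<tau> n) (\<sigma> n) =
        ereal ((\<sigma> n)\<^sup>2 * real (k n) * R n) \<and> \<bar>(\<nu> n)\<^sup>2 - 6 * ln (\<nu> n) - R n\<bar> \<le> C
        \<and> ln (\<nu> n) > 0 \<and> \<epsilon> n = real (k n) / real n \<and> n \<ge> 1 \<and> (\<nu> n)\<^sup>2 = 2 * ln (inverse (\<epsilon> n))"
    using eventually_ge_at_top[of 1] pos small1 small2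
      filterlim_at_top_dense[THEN iffD1, OF nu, rule_format, of 1]
      eventually_compose_filterlim[OF growth nu]
  proof eventually_elim
    case (elim n)
    have k: "1 \<le> k n" "2 * k n \<le> n"
      using elim assms(4)[of n] by (auto simp: \<epsilon>_def field_simps)
    have s: "\<sigma> n > 0" and mu: "\<mu> n > 0"
      using elim assms(5,6)[of n] by (auto simp: \<mu>_def)
    have "ln (inverse (\<epsilon> n)) > 0"
      using elim by (intro ln_gt_zero) (auto simp: field_simps)
    then have nu2: "(\<nu> n)\<^sup>2 = 2 * ln (inverse (\<epsilon> n))"
      by (simp add: \<nu>_def)
    have e: "exp (- (\<nu> n)\<^sup>2 / 2) = real (k n) / real n"
      using elim by (simp add: nu2 ln_inverse) (simp add: \<epsilon>_def)
    have "3 * sqrt (ln (inverse (\<epsilon> n))) \<le> \<mu> n"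
      using elim mu by (simp add: field_simps)
    moreover have "2 * sqrt 2 \<le> (3::real)"
      by (rule power2_le_imp_le) (auto simp: power_mult_distrib)
    then have "2 * sqrt 2 * sqrt (ln (inverse (\<epsilon> n))) \<le> 3 * sqrt (ln (inverse (\<epsilon> n)))"
      using \<open>ln (inverse (\<epsilon> n)) > 0\<close> by (intro mult_right_mono) auto
    ultimately have m: "2 * \<nu> n \<le> \<tau> n / \<sigma> n"
      by (simp add: \<nu>_def real_sqrt_mult \<mu>_def)
    have n1: "\<nu> n \<ge> 1" "ln (\<nu> n) > 0" using elim by auto
    let ?o = "optimal_soft_risk n (k n) (\<tau> n) (\<sigma> n)"
    have up: "?o \<le> ereal ((\<sigma> n)\<^sup>2 * real (k n) * ((\<nu> n)\<^sup>2 - 6 * ln (\<nu> n) + 33))"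
      using k elim by (intro optimal_soft_risk_le s n1 e) auto
    have lo: "ereal ((\<sigma> n)\<^sup>2 * real (k n) * ((\<nu> n)\<^sup>2 - 6 * ln (\<nu> n)
        + (2 * ln (tail_const / 2) - 6 * ln 2 - 3))) \<le> ?o"
      by (intro optimal_soft_risk_ge s k n1 e m)
    obtain x where x: "?o = ereal x"
      using up lo by (cases ?o) auto
    define c where "c = (\<sigma> n)\<^sup>2 * real (k n)"
    have c: "c > 0" using s k by (simp add: c_def)
    have R: "c * R n = x" using c by (simp add: R_def x flip: c_def)
    have "R n \<le> (\<nu> n)\<^sup>2 - 6 * ln (\<nu> n) + 33"
      using up c unfolding x R[symmetric] c_def[symmetric] by simp
    moreover have "(\<nu> n)\<^sup>2 - 6 * ln (\<nu> n) + (2 * ln (tail_const / 2) - 6 * ln 2 - 3) \<le> R n"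
      using lo c unfolding x R[symmetric] c_def[symmetric] by simp
    ultimately have "\<bar>(\<nu> n)\<^sup>2 - 6 * ln (\<nu> n) - R n\<bar> \<le> C"
      unfolding C_def by linarith
    then show ?case
      using x R n1 elim nu2 by (simp add: c_def \<epsilon>_def)
  qed
  have "r \<longlonglongrightarrow> 0"
  proof (rule Lim_null_comparison)
    show "\<forall>\<^sub>F n in sequentially. norm (r n) \<le> C / (6 * ln (\<nu> n))"
      using key by eventually_elim (auto simp: r_def intro!: divide_right_mono)
    have "filterlim (\<lambda>n. 6 * ln (\<nu> n)) at_top sequentially"
      by (intro filterlim_tendsto_pos_mult_at_top[OF tendsto_const] filterlim_compose[OF ln_at_top nu]) auto
    then show "(\<lambda>n. C / (6 * ln (\<nu> n))) \<longlonglongrightarrow> 0"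
      by (intro tendsto_divide_0[OF tendsto_const] filterlim_at_top_imp_at_infinity)
  qed
  moreover have "\<forall>\<^sub>F n in sequentially. optimal_soft_risk n (k n) (\<tau> n) (\<sigma> n) =
        ereal (real n * (\<sigma> n)\<^sup>2 *
          (2 * \<epsilon> n * ln (inverse (\<epsilon> n)) - 6 * \<epsilon> n * ln (\<nu> n) * (1 + r n)))"
    using key
  proof eventually_elim
    case (elim n)
    have "6 * ln (\<nu> n) * (1 + r n) = (\<nu> n)\<^sup>2 - R n"
      using elim by (simp add: r_def field_simps)
    then have "R n = 2 * ln (inverse (\<epsilon> n)) - 6 * ln (\<nu> n) * (1 + r n)"
      using elim by simp
    then have "\<epsilon> n * R n = 2 * \<epsilon> n * ln (inverse (\<epsilon> n)) - 6 * \<epsilon> n * ln (\<nu> n) * (1 + r n)"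
      by (simp only: right_diff_distrib mult_ac)
    moreover have "(\<sigma> n)\<^sup>2 * real (k n) * R n = real n * (\<sigma> n)\<^sup>2 * (\<epsilon> n * R n)"
      using elim by simp
    ultimately show ?case
      using elim by simp
  qed
  ultimately show ?thesis by blast
qed

end
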